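(* Let $p,q$ be relatively prime positive integers and $i,j\ge1$. Let $\frac{t_{ij}(p,q)}{i!\,j!}$ be the coefficient of $x_1^ix_2^j$ in $\mathrm{Td}_{pq}(x_1,x_2)$. Then $$t_{ij}(p,q)=-(-q)^{i+j-1}\big(s_{ij}(p,q)+\delta(i,j)B_iB_j\big),$$ where $\delta(i,j)=1$ if $i=1$ or $j=1$, and $\delta(i,j)=0$ otherwise.
   Context: $\mathrm{Td}_{pq}$ denotes the Todd series of the lattice cone generated by $v_1=(1,0)$ and $v_2=(p,q)$: with $M_\sigma=\mathbb Zv_1+\mathbb Zv_2$, $\Gamma=\mathbb Z^2/M_\sigma$, writing $g=a_1(g)v_1+a_2(g)v_2$ ($a_i(g)\in\mathbb Q$) and $\chi_i(\gamma)=\exp(2\pi i\,a_i(g))$, $\mathrm{Td}_{pq}(x_1,x_2)=\sum_{\gamma\in\Gamma}\frac{x_1}{1-\chi_1(\gamma)e^{-x_1}}\frac{x_2}{1-\chi_2(\gamma)e^{-x_2}}$ as a power series at $0$. Bernoulli numbers: $\frac{z}{e^z-1}=\sum_k\frac{B_k}{k!}z^k$; Bernoulli polynomials: $\frac{ze^{xz}}{e^z-1}=\sum_k\frac{B_k(x)}{k!}z^k$. Periodic Bernoulli function: $\bar B_k(x)=B_k(x-\lfloor x\rfloor)$ for $x\notin\mathbb Z$, $\bar B_k(x)=B_k$ for $k\ge2$, $x\in\mathbb Z$, $\bar B_1(x)=0$ for $x\in\mathbb Z$. $s_{ij}(p,q)=\sum_{k=0}^{q-1}\bar B_i(k/q)\bar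 B_j(pk/q)$. *)

theory Defs
  imports "HOL-Analysis.Analysis" "HOL-Computational_Algebra.Formal_Power_Series"
begin

definition bernoulli :: "nat \<Rightarrow> real" where
  "bernoulli k = fact k * fps_nth (fps_X / (fps_exp 1 - 1)) k"

definition bernpoly :: "nat \<Rightarrow> real \<Rightarrow> real" where
  "bernpoly k x = fact k * fps_nth (fps_X * fps_exp x / (fps_exp 1 - 1)) k"

definition pbernoulli :: "nat \<Rightarrow> real \<Rightarrow> real" where
  "pbernoulli k x =
     (if x \<notin> \<int> then bernpoly k (frac x) else if k = 1 then 0 else bernoulli k)"

definition dedekind_s :: "nat \<Rightarrow> nat \<Rightarrow> nat \<Rightarrow> nat \<Rightarrow> real" where
  "dedekind_s i j p q =
     (\<Sum>k<q. pbernoulli i (real k / real q) * pbernoulli j (real p * real k / real q))"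

definition cone_lattice :: "int \<times> int \<Rightarrow> int \<times> int \<Rightarrow> (int \<times> int) set" where
  "cone_lattice v1 v2 =
     {(m * fst v1 + n * fst v2, m * snd v1 + n * snd v2) | m n. True}"

definition cone_group :: "int \<times> int \<Rightarrow> int \<times> int \<Rightarrow> (int \<times> int) set set" where
  "cone_group v1 v2 = UNIV // {(g, h). g - h \<in> cone_lattice v1 v2}"

definition cone_coords :: "int \<times> int \<Rightarrow> int \<times> int \<Rightarrow> int \<times> int \<Rightarrow> rat \<times> rat" where
  "cone_coords v1 v2 g = (THE a.
     of_int (fst g) = fst a * of_int (fst v1) + snd a * of_int (fst v2) \<and>
     of_int (snd g) = fst a * of_int (snd v1) + snd a * of_int (snd v2))"

text \<open>
  The characters are evaluated on an arbitrary representative of the coset; the lemma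
  \<open>cone_char_eq\<close> below shows that the choice is irrelevant.
\<close>

definition cone_char1 :: "int \<times> int \<Rightarrow> int \<times> int \<Rightarrow> (int \<times> int) set \<Rightarrow> complex" where
  "cone_char1 v1 v2 \<gamma> =
     exp (2 * of_real pi * \<i> * of_rat (fst (cone_coords v1 v2 (SOME g. g \<in> \<gamma>))))"

definition cone_char2 :: "int \<times> int \<Rightarrow> int \<times> int \<Rightarrow> (int \<times> int) set \<Rightarrow> complex" where
  "cone_char2 v1 v2 \<gamma> =
     exp (2 * of_real pi * \<i> * of_rat (snd (cone_coords v1 v2 (SOME g. g \<in> \<gamma>))))"

text \<open>
  Series in two variables are represented by the type \<open>complex fps fps\<close>, the outer variable being
  \<open>x\<^sub>1\<close> and the inner one \<open>x\<^sub>2\<close>, so that the coefficient of \<open>x\<^sub>1\<^sup>i x\<^sub>2\<^sup>j\<close> in \<open>F\<close> is \<open>fps_nth (fps_nth F i) j\<close>.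
  The next two functions read a series in one variable as a series in \<open>x\<^sub>1\<close> and in \<open>x\<^sub>2\<close>.
\<close>

definition in_x1 :: "complex fps \<Rightarrow> complex fps fps" where
  "in_x1 f = Abs_fps (\<lambda>n. fps_const (fps_nth f n))"

definition in_x2 :: "complex fps \<Rightarrow> complex fps fps" where
  "in_x2 f = fps_const f"

text \<open>
  For \<open>c = 1\<close> the divisor below has zero constant coefficient, but the division is still exact;
  see the lemma \<open>todd_factor_mult\<close>.
\<close>

definition todd_factor :: "complex \<Rightarrow> complex fps" where
  "todd_factor c = fps_X / (1 - fps_const c * fps_exp (- 1))"

definition todd_series :: "int \<times> int \<Rightarrow> int \<times> int \<Rightarrow> complex fps fps" where
  "todd_series v1 v2 = (\<Sum>\<gamma> \<in> cone_group v1 v2.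
     in_x1 (todd_factor (cone_char1 v1 v2 \<gamma>)) * in_x2 (todd_factor (cone_char2 v1 v2 \<gamma>)))"

definition Td :: "nat \<Rightarrow> nat \<Rightarrow> complex fps fps" where
  "Td p q = todd_series (1, 0) (int p, int q)"

lemma todd_factor_mult: "todd_factor c * (1 - fps_const c * fps_exp (- 1)) = fps_X"
proof -
  let ?d = "1 - fps_const c * fps_exp (- 1)"
  have d1: "fps_nth ?d 1 = c" and d0: "fps_nth ?d 0 = 1 - c" by (simp_all add: fps_exp_def)
  have nz: "?d \<noteq> 0" using d0 d1 by (metis eq_iff_diff_eq_0 fps_zero_nth zero_neq_one)
  have "subdegree ?d \<le> 1"
  proof (cases "c = 0")
    case True
    then show ?thesis by simp
  next
    case False
    then show ?thesis using d1 by (intro subdegree_leI) auto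
  qed
  then have "?d dvd fps_X" using nz by (subst fps_dvd_iff) auto
  then show ?thesis by (simp add: todd_factor_def)
qed

lemma in_x_nth: "fps_nth (fps_nth (in_x1 f * in_x2 g) i) j = fps_nth f i * fps_nth g j"
  by (simp add: in_x1_def in_x2_def)

lemma cone_coords_eqI:
  assumes "fst v1 * snd v2 \<noteq> snd v1 * fst v2"
    and "of_int (fst g) = a * of_int (fst v1) + b * of_int (fst v2)"
    and "of_int (snd g) = a * of_int (snd v1) + b * of_int (snd v2)"
  shows "cone_coords v1 v2 g = (a, b)"
  unfolding cone_coords_def
proof (rule the_equality)
  fix c :: "rat \<times> rat"
  assume c: "of_int (fst g) = fst c * of_int (fst v1) + snd c * of_int (fst v2) \<and>
    of_int (snd g) = fst c * of_int (snd v1) + snd c * of_int (snd v2)"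
  define D :: rat where "D = of_int (fst v1 * snd v2 - snd v1 * fst v2)"
  have D: "D \<noteq> 0" using assms(1) by (simp add: D_def del: of_int_mult of_int_diff)
  have "D * (fst c - a) = 0" "D * (snd c - b) = 0"
    using c assms(2,3) unfolding D_def of_int_mult of_int_diff by algebra+
  then show "c = (a, b)" using D by (simp add: prod_eq_iff)
qed (use assms in auto)

lemma cone_coords_standard:
  assumes "q > 0"
  shows "cone_coords (1, 0) (int p, int q) (m, n) =
    (of_int m - of_nat p * of_int n / of_nat q, of_int n / of_nat q)"
  using assms by (intro cone_coords_eqI) (auto simp: field_simps)

lemma cone_coords_add:
  assumes "fst v1 * snd v2 \<noteq> snd v1 * fst v2" "g - h \<in> cone_lattice v1 v2"
  obtains m n where "fst (cone_coords v1 v2 g) = fst (cone_coords v1 v2 h) + of_int m"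
    "snd (cone_coords v1 v2 g) = snd (cone_coords v1 v2 h) + of_int n"
proof -
  obtain m n where mn: "fst g = fst h + m * fst v1 + n * fst v2"
      "snd g = snd h + m * snd v1 + n * snd v2"
    using assms(2) by (auto simp: cone_lattice_def prod_eq_iff algebra_simps)
  define D :: rat where "D = of_int (fst v1 * snd v2 - snd v1 * fst v2)"
  have D: "D \<noteq> 0" using assms(1) by (simp add: D_def del: of_int_mult of_int_diff)
  define a :: rat where "a = of_int (fst h * snd v2 - snd h * fst v2) / D"
  define b :: rat where "b = of_int (fst v1 * snd h - snd v1 * fst h) / D"
  have ab: "a * D = of_int (fst h * snd v2 - snd h * fst v2)"
    "b * D = of_int (fst v1 * snd h - snd v1 * fst h)"
    using D by (auto simp: a_def b_def)
  have "D * (a * of_int (fst v1) + b * of_int (fst v2)) = D * of_int (fst h)"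
    "D * (a * of_int (snd v1) + b * of_int (snd v2)) = D * of_int (snd h)"
    using ab unfolding D_def of_int_mult of_int_diff by algebra+
  then have h: "of_int (fst h) = a * of_int (fst v1) + b * of_int (fst v2)"
    "of_int (snd h) = a * of_int (snd v1) + b * of_int (snd v2)"
    using D by auto
  have "cone_coords v1 v2 h = (a, b)"
    by (rule cone_coords_eqI[OF assms(1) h])
  moreover have "cone_coords v1 v2 g = (a + of_int m, b + of_int n)"
    by (rule cone_coords_eqI[OF assms(1)]) (simp_all add: mn h algebra_simps)
  ultimately show ?thesis by (intro that[of m n]) auto
qed

lemma exp_2pi_add_int:
  "exp (2 * of_real pi * \<i> * of_rat (a + of_int m)) = exp (2 * of_real pi * \<i> * of_rat a)"
proof -
  have "2 * of_real pi * \<i> * of_rat (a + of_int m) =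
      2 * of_real pi * \<i> * of_rat a + of_int (2 * m) * (of_real pi * \<i>)"
    by (simp add: of_rat_add algebra_simps)
  then show ?thesis
    unfolding exp_eq by (intro exI[of _ m]) (simp add: algebra_simps)
qed

lemma cone_char_eq:
  assumes "fst v1 * snd v2 \<noteq> snd v1 * fst v2" "\<gamma> \<in> cone_group v1 v2" "g \<in> \<gamma>"
  shows "cone_char1 v1 v2 \<gamma> = exp (2 * of_real pi * \<i> * of_rat (fst (cone_coords v1 v2 g)))"
    and "cone_char2 v1 v2 \<gamma> = exp (2 * of_real pi * \<i> * of_rat (snd (cone_coords v1 v2 g)))"
proof -
  define h where "h = (SOME g. g \<in> \<gamma>)"
  have "h \<in> \<gamma>" unfolding h_def using assms(3) by (rule someI)
  obtain w where w: "\<gamma> = {x. w - x \<in> cone_lattice v1 v2}"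
    using assms(2) by (auto simp: cone_group_def quotient_def)
  have minus: "x - y \<in> cone_lattice v1 v2"
    if "x \<in> cone_lattice v1 v2" "y \<in> cone_lattice v1 v2" for x y
  proof -
    from that obtain m n m' n' where
      "x = (m * fst v1 + n * fst v2, m * snd v1 + n * snd v2)"
      "y = (m' * fst v1 + n' * fst v2, m' * snd v1 + n' * snd v2)"
      by (auto simp: cone_lattice_def)
    then have "x - y = ((m - m') * fst v1 + (n - n') * fst v2, (m - m') * snd v1 + (n - n') * snd v2)"
      by (simp add: algebra_simps)
    then show ?thesis unfolding cone_lattice_def by blast
  qed
  have "(w - g) - (w - h) \<in> cone_lattice v1 v2"
    by (rule minus) (use assms(3) \<open>h \<in> \<gamma>\<close> in \<open>auto simp: w\<close>)
  then have "h - g \<in> cone_lattice v1 v2" by simp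
  then obtain m n where "fst (cone_coords v1 v2 h) = fst (cone_coords v1 v2 g) + of_int m"
      "snd (cone_coords v1 v2 h) = snd (cone_coords v1 v2 g) + of_int n"
    using cone_coords_add[OF assms(1)] by blast
  then show "cone_char1 v1 v2 \<gamma> = exp (2 * of_real pi * \<i> * of_rat (fst (cone_coords v1 v2 g)))"
    and "cone_char2 v1 v2 \<gamma> = exp (2 * of_real pi * \<i> * of_rat (snd (cone_coords v1 v2 g)))"
    by (simp_all only: cone_char1_def cone_char2_def h_def[symmetric] exp_2pi_add_int)
qed

end

theory Submission
  imports Defs
begin

text \<open>
  If \<open>c\<^sup>q = 1\<close>, then \<open>(1 - c e\<^sup>-\<^sup>x) \<cdot> \<Sum>k<q. c\<^sup>k e\<^sup>-\<^sup>k\<^sup>x = 1 - e\<^sup>-\<^sup>q\<^sup>x\<close>, so the coefficients of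
  \<open>x / (1 - c e\<^sup>-\<^sup>x)\<close> are finite Fourier sums, over \<open>k < q\<close>, of the values \<open>B\<^sub>n(k/q)\<close>.
  The group \<open>\<Gamma>\<close> is cyclic, represented by \<open>(0, n)\<close> for \<open>n < q\<close>, with
  characters \<open>\<omega>\<^sup>-\<^sup>p\<^sup>n\<close> and \<open>\<omega>\<^sup>n\<close> for \<open>\<omega> = exp (2\<pi>\<i>/q)\<close>. Summing the product of two
  Fourier sums over \<open>\<Gamma>\<close>, orthogonality leaves only the pairs \<open>(k, l)\<close> with \<open>l \<equiv> p k (mod q)\<close>. The
  \<open>\<delta>\<close> term corrects the convention that the first periodic Bernoulli function vanishes at \<open>0\<close>.
\<close>

section \<open>Bernoulli generating functions and Todd factors at roots of unity\<close>

lemma bernpoly_0: "bernpoly k 0 = bernoulli k"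
  by (simp add: bernpoly_def bernoulli_def)

text \<open>The divisor has no constant term, so it is not a unit; the division is exact because its
  subdegree is at most 1 and the numerator carries the factor \<open>fps_X\<close>.\<close>

lemma bernpoly_fps_mult:
  "(fps_X * fps_exp a / (fps_exp 1 - 1)) * (fps_exp 1 - 1) = fps_X * fps_exp (a :: real)"
proof -
  have "fps_nth (fps_exp (1::real) - 1) 1 = 1" by simp
  then have nz: "fps_exp (1::real) - 1 \<noteq> 0" and "subdegree (fps_exp (1::real) - 1) \<le> 1"
    by (metis fps_zero_nth zero_neq_one) (intro subdegree_leI, simp)
  then have "fps_exp (1::real) - 1 dvd fps_X"
    by (subst fps_dvd_iff) auto
  then have "fps_exp (1::real) - 1 dvd fps_X * fps_exp a"
    by (rule dvd_mult2)
  then show ?thesis by simp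
qed

text \<open>The series z e^(az) / (e^z - 1) carried over to complex coefficients, where the Todd
  factors live.\<close>

definition bernpoly_egf :: "real \<Rightarrow> complex fps" where
  "bernpoly_egf a = Abs_fps (\<lambda>n. of_real (bernpoly n a / fact n))"

lemma bernpoly_egf_mult:
  "bernpoly_egf a * (fps_exp 1 - 1) = fps_X * fps_exp (of_real a)"
proof (rule fps_ext)
  fix n
  define F where "F = fps_X * fps_exp a / (fps_exp 1 - 1)"
  have F: "bernpoly m a / fact m = fps_nth F m" for m
    by (simp add: bernpoly_def F_def)
  have "fps_nth (bernpoly_egf a * (fps_exp 1 - 1)) n = of_real (fps_nth (F * (fps_exp 1 - 1)) n)"
    by (simp add: fps_mult_nth bernpoly_egf_def F if_distrib cong: if_cong)
  also have "\<dots> = fps_nth (fps_X * fps_exp (of_real a)) n"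
    unfolding F_def bernpoly_fps_mult by simp
  finally show "fps_nth (bernpoly_egf a * (fps_exp 1 - 1)) n = \<dots>" .
qed

lemma todd_factor_root_of_unity_nth:
  assumes q: "q > 0" and c: "c ^ q = 1"
  shows "fps_nth (todd_factor c) n =
    (- of_nat q) ^ n / (of_nat q * fact n) *
      (\<Sum>k<q. c ^ k * of_real (bernpoly n (real k / real q)))"
proof -
  let ?L = "fps_const (- of_nat q) * fps_X :: complex fps"
  \<comment> \<open>Substituting z = -qx turns z e^(kz/q) / (e^z - 1) into q x e^(-kx) / (1 -
    e^(-qx)), so all k share the denominator \<open>D\<close>.\<close>
  define G where "G k = bernpoly_egf (real k / real q) oo ?L" for k
  define S where "S = (\<Sum>k<q. fps_const (c ^ k) * G k)"
  define d where "d = 1 - fps_const c * fps_exp (- 1)"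
  define D :: "complex fps" where "D = 1 - fps_exp (- of_nat q)"
  have exp_L: "fps_exp a oo ?L = fps_exp (- (a * of_nat q))" for a :: complex
    by (subst fps_exp_compose_linear) simp
  have G: "G k * D = fps_const (of_nat q) * (fps_X * fps_exp (- of_nat k))" for k
  proof -
    have "(bernpoly_egf (real k / real q) * (fps_exp 1 - 1)) oo ?L =
        (fps_X * fps_exp (of_real (real k / real q))) oo ?L"
      by (simp only: bernpoly_egf_mult)
    then have "G k * (fps_exp (- of_nat q) - 1) = ?L * fps_exp (- of_nat k)"
      using q by (simp add: fps_compose_mult_distrib fps_compose_sub_distrib exp_L G_def)
    then have "- (G k * (fps_exp (- of_nat q) - 1)) = - (?L * fps_exp (- of_nat k))"
      by simp
    then show ?thesis by (simp add: D_def algebra_simps flip: fps_const_neg)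
  qed
  have geom: "d * (\<Sum>k<q. fps_const (c ^ k) * fps_exp (- of_nat k)) = D"
  proof -
    have pow: "(fps_const c * fps_exp (- 1)) ^ k = fps_const (c ^ k) * fps_exp (- of_nat k)" for k
      by (simp add: power_mult_distrib fps_exp_power_mult)
    show ?thesis
      using one_diff_power_eq[of "fps_const c * fps_exp (- 1)" q] c
      by (simp add: pow d_def D_def)
  qed
  have "fps_nth D 1 \<noteq> 0" using q by (simp add: D_def)
  then have D0: "D \<noteq> 0" by auto
  have td: "todd_factor c * d = fps_X" unfolding d_def by (rule todd_factor_mult)
  have "S * D = fps_const (of_nat q) * (fps_X * (\<Sum>k<q. fps_const (c ^ k) * fps_exp (- of_nat k)))"
    by (simp add: S_def sum_distrib_right sum_distrib_left mult.assoc G mult.left_commute)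
  also have "\<dots> = fps_const (of_nat q) * todd_factor c * D"
    \<comment> \<open>\<open>fps_X\<close> is expanded to \<open>todd_factor c * d\<close> and
      \<open>D\<close> to \<open>d\<close> times the geometric sum; both sides then have the same
      factors.\<close>
    by (simp only: flip: td geom) (simp only: mult_ac)
  \<comment> \<open>Power series over a field form an integral domain, so \<open>D\<close> cancels
    although it is not a unit. This includes c = 1.\<close>
  finally have "S = fps_const (of_nat q) * todd_factor c" using D0 by simp
  then have "of_nat q * fps_nth (todd_factor c) n = fps_nth S n" by simp
  also have "\<dots> = (\<Sum>k<q. c ^ k * ((- of_nat q) ^ n * of_real (bernpoly n (real k / real q) / fact n)))"
    by (simp add: S_def G_def fps_sum_nth fps_compose_linear bernpoly_egf_def)
  also have "\<dots> = (- of_nat q) ^ n / fact n * (\<Sum>k<q. c ^ k * of_real (bernpoly n (real k / real q)))"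
    by (simp add: sum_distrib_left mult_ac)
  finally show ?thesis using q by (simp add: field_simps)
qed

section \<open>The cone group as the integers modulo q\<close>

lemma cone_lattice_standard:
  "(m, n) \<in> cone_lattice (1, 0) (int p, int q) \<longleftrightarrow> int q dvd n"
proof
  assume "int q dvd n"
  then obtain k where "n = int q * k" ..
  then have "(m, n) = ((m - k * int p) * 1 + k * int p, (m - k * int p) * 0 + k * int q)"
    by simp
  then show "(m, n) \<in> cone_lattice (1, 0) (int p, int q)"
    unfolding cone_lattice_def fst_conv snd_conv by blast
qed (auto simp: cone_lattice_def)

definition cone_coset :: "nat \<Rightarrow> nat \<Rightarrow> (int \<times> int) set" where
  "cone_coset q n = {g. int q dvd int n - snd g}"

text \<open>As (1, 0) is a lattice generator, a class is determined by its second coordinate modulo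
  q; \<open>cone_coset q n\<close> is the class of (0, n).\<close>

lemma bij_betw_cone_coset:
  assumes "q > 0"
  shows "bij_betw (cone_coset q) {..<q} (cone_group (1, 0) (int p, int q))"
proof -
  have group: "cone_group (1, 0) (int p, int q) =
      range (\<lambda>w :: int \<times> int. {g :: int \<times> int. int q dvd snd w - snd g})"
  proof -
    have "{(g, h). g - h \<in> cone_lattice (1, 0) (int p, int q)} `` {w} =
        {g. int q dvd snd w - snd g}" for w
      by (auto simp: cone_lattice_standard minus_prod_def)
    then show ?thesis
      by (simp add: cone_group_def quotient_def UNION_singleton_eq_range)
  qed
  have "inj_on (cone_coset q) {..<q}"
  proof (rule inj_onI)
    fix m n assume "m \<in> {..<q}" "n \<in> {..<q}" and eq: "cone_coset q m = cone_coset q n"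
    have "(0, int n) \<in> cone_coset q n" by (simp add: cone_coset_def)
    then have "(0, int n) \<in> cone_coset q m" unfolding eq .
    then have "int q dvd int m - int n" by (simp add: cone_coset_def)
    then have "int m mod int q = int n mod int q" by (simp add: mod_eq_dvd_iff)
    then show "m = n" using \<open>m \<in> {..<q}\<close> \<open>n \<in> {..<q}\<close> by simp
  qed
  moreover have "cone_coset q ` {..<q} = cone_group (1, 0) (int p, int q)"
    unfolding group
  proof (intro equalityI subsetI)
    fix \<gamma> assume "\<gamma> \<in> cone_coset q ` {..<q}"
    then obtain n where "\<gamma> = {g. int q dvd snd (0 :: int, int n) - snd g}"
      by (auto simp: cone_coset_def)
    then show "\<gamma> \<in> range (\<lambda>w :: int \<times> int. {g :: int \<times> int. int q dvd snd w - snd g})" by blast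
  next
    fix \<gamma> assume "\<gamma> \<in> range (\<lambda>w :: int \<times> int. {g :: int \<times> int. int q dvd snd w - snd g})"
    then obtain w :: "int \<times> int" where \<gamma>: "\<gamma> = {g. int q dvd snd w - snd g}" by blast
    \<comment> \<open>Reducing the second coordinate modulo q keeps the class, which gives a
      representative in range.\<close>
    have "int q dvd snd w - x \<longleftrightarrow> int q dvd snd w mod int q - x" for x
      by (simp flip: mod_eq_dvd_iff)
    then have "\<gamma> = cone_coset q (nat (snd w mod int q))"
      using assms by (simp add: \<gamma> cone_coset_def)
    moreover have "nat (snd w mod int q) < q"
      using assms by (simp add: nat_less_iff)
    ultimately show "\<gamma> \<in> cone_coset q ` {..<q}" by blast
  qed
  ultimately show ?thesis by (simp add: bij_betw_def)
qed

section \<open>Characters, orthogonality and the coefficients of the Todd series\<close>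

definition unity_root :: "nat \<Rightarrow> int \<Rightarrow> complex" where
  "unity_root q m = cis (2 * pi * of_int m / of_nat q)"

lemma unity_root_add: "unity_root q (m + n) = unity_root q m * unity_root q n"
  by (simp add: unity_root_def cis_mult algebra_simps add_divide_distrib)

lemma unity_root_power: "unity_root q m ^ n = unity_root q (m * int n)"
  by (simp add: unity_root_def Complex.DeMoivre mult_ac)

lemma unity_root_eq_1_iff:
  assumes "q > 0"
  shows "unity_root q m = 1 \<longleftrightarrow> int q dvd m"
proof -
  have "unity_root q m = 1 \<longleftrightarrow> (\<exists>n. 2 * pi * of_int m / of_nat q = of_int (2 * n) * pi)"
    by (simp add: unity_root_def cis_conv_exp exp_eq_1)
  also have "\<dots> \<longleftrightarrow> (\<exists>n. (of_int m :: real) = of_int (int q * n))"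
    using assms by (intro ex_cong1) (auto simp: field_simps)
  also have "\<dots> \<longleftrightarrow> int q dvd m"
    unfolding of_int_eq_iff dvd_def ..
  finally show ?thesis .
qed

text \<open>A geometric sum whose product with 1 - \<open>unity_root q m\<close> is 0: either the
  ratio is 1 or the sum vanishes.\<close>

lemma sum_unity_root:
  assumes "q > 0"
  shows "(\<Sum>n<q. unity_root q (m * int n)) = (if int q dvd m then of_nat q else 0)"
proof -
  have "unity_root q m ^ q = 1"
    by (simp add: unity_root_power unity_root_eq_1_iff assms)
  then have "(1 - unity_root q m) * (\<Sum>n<q. unity_root q m ^ n) = 0"
    using one_diff_power_eq[of "unity_root q m" q] by simp
  then show ?thesis
    unfolding unity_root_power[symmetric] unity_root_eq_1_iff[OF assms, symmetric] by auto
qed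

text \<open>By \<open>cone_char_eq\<close> the representative (0, n) may be used; its coordinates
  are -pn/q and n/q.\<close>

lemma cone_char_cone_coset:
  assumes "q > 0" "n < q"
  shows "cone_char1 (1, 0) (int p, int q) (cone_coset q n) = unity_root q (- (int p * int n))"
    and "cone_char2 (1, 0) (int p, int q) (cone_coset q n) = unity_root q (int n)"
proof -
  have ndeg: "fst (1, 0 :: int) * snd (int p, int q) \<noteq> snd (1 :: int, 0) * fst (int p, int q)"
    using assms by simp
  have coset: "cone_coset q n \<in> cone_group (1, 0) (int p, int q)"
    using bij_betw_cone_coset[OF assms(1)] assms(2) by (auto simp: bij_betw_def)
  have mem: "(0, int n) \<in> cone_coset q n"
    by (simp add: cone_coset_def)
  show "cone_char1 (1, 0) (int p, int q) (cone_coset q n) = unity_root q (- (int p * int n))"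
    and "cone_char2 (1, 0) (int p, int q) (cone_coset q n) = unity_root q (int n)"
    unfolding cone_char_eq[OF ndeg coset mem] cone_coords_standard[OF assms(1)]
    by (simp_all add: unity_root_def cis_conv_exp of_rat_divide of_rat_mult of_rat_minus mult_ac)
qed

text \<open>Each Todd factor contributes 1/q, and orthogonality returns one factor q, so a single
  1/q remains.\<close>

lemma Td_nth_eq_sum_bernpoly:
  assumes q: "q > 0"
  shows "fps_nth (fps_nth (Td p q) i) j =
    (- of_nat q) ^ (i + j) / (of_nat q * fact i * fact j) *
      (\<Sum>k<q. of_real (bernpoly i (real k / real q) * bernpoly j (real (p * k mod q) / real q)))"
proof -
  define b where "b n k = complex_of_real (bernpoly n (real k / real q))" for n k
  define K :: "nat \<Rightarrow> complex" where "K n = (- of_nat q) ^ n / (of_nat q * fact n)" for n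
  have root: "unity_root q m ^ q = 1" for m
    by (simp add: unity_root_power unity_root_eq_1_iff q)
  have "fps_nth (fps_nth (Td p q) i) j = (\<Sum>n<q.
      fps_nth (todd_factor (unity_root q (- (int p * int n)))) i *
      fps_nth (todd_factor (unity_root q (int n))) j)"
    unfolding Td_def todd_series_def fps_sum_nth in_x_nth
    by (subst sum.reindex_bij_betw[OF bij_betw_cone_coset[OF q], symmetric])
       (simp add: cone_char_cone_coset q)
  also have "\<dots> = (\<Sum>n<q. K i * K j *
      ((\<Sum>k<q. unity_root q (- (int p * int n)) ^ k * b i k) *
       (\<Sum>l<q. unity_root q (int n) ^ l * b j l)))"
    by (simp add: todd_factor_root_of_unity_nth[OF q root] K_def b_def mult_ac)
  also have "\<dots> = K i * K j * (\<Sum>n<q. \<Sum>k<q. \<Sum>l<q.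
      unity_root q ((int l - int p * int k) * int n) * (b i k * b j l))"
  proof -
    have "unity_root q ((int l - int p * int k) * int n) =
        unity_root q (- (int p * int n)) ^ k * unity_root q (int n) ^ l" for k l n
      by (simp add: unity_root_power algebra_simps flip: unity_root_add)
    then show ?thesis
      by (simp add: sum_distrib_left sum_product mult_ac)
  qed
  also have "(\<Sum>n<q. \<Sum>k<q. \<Sum>l<q.
      unity_root q ((int l - int p * int k) * int n) * (b i k * b j l)) =
    (\<Sum>k<q. \<Sum>l<q. (\<Sum>n<q. unity_root q ((int l - int p * int k) * int n)) * (b i k * b j l))"
    \<comment> \<open>The sum over n moves innermost, where it is a pure character sum.\<close>
    by (subst sum.swap, rule sum.cong[OF refl], subst sum.swap) (simp add: sum_distrib_right)
  also have "\<dots> = (\<Sum>k<q. \<Sum>l<q. if l = p * k mod q then of_nat q * (b i k * b j l) else 0)"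
  proof (intro sum.cong refl)
    fix k l assume "l \<in> {..<q}"
    have "int q dvd int l - int p * int k \<longleftrightarrow> int l mod int q = int (p * k) mod int q"
      by (simp add: mod_eq_dvd_iff)
    also have "\<dots> \<longleftrightarrow> l = p * k mod q"
      using \<open>l \<in> {..<q}\<close> unfolding zmod_int[symmetric] of_nat_eq_iff by simp
    finally show "(\<Sum>n<q. unity_root q ((int l - int p * int k) * int n)) * (b i k * b j l) =
        (if l = p * k mod q then of_nat q * (b i k * b j l) else 0)"
      by (simp add: sum_unity_root[OF q])
  qed
  also have "\<dots> = of_nat q * (\<Sum>k<q. b i k * b j (p * k mod q))"
    using q by (simp add: sum_distrib_left)
  finally show ?thesis
    using q by (simp add: K_def b_def power_add mult_ac)
qed

section \<open>Comparison with the periodic Bernoulli sum\<close>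

lemma frac_of_nat_divide:
  assumes "q > 0"
  shows "frac (real m / real q) = real (m mod q) / real q"
proof -
  have "real m = real q * real (m div q) + real (m mod q)"
    by (metis mult_div_mod_eq of_nat_add of_nat_mult)
  then have "real m / real q - real (m mod q) / real q = of_int (int (m div q))"
    using assms by (simp add: field_simps)
  then show ?thesis
    using assms by (auto simp: frac_unique_iff)
qed

text \<open>For 0 < k < q neither k/q nor pk/q is an integer, by coprimality, so the terms agree. At
  k = 0 the left side has \<open>bernoulli i * bernoulli j\<close>, whereas the periodic product is
  0 when i or j is 1.\<close>

lemma sum_bernpoly_eq_dedekind_s:
  assumes "q > 0" "coprime p q"
  shows "(\<Sum>k<q. bernpoly i (real k / real q) * bernpoly j (real (p * k mod q) / real q)) =
    dedekind_s i j p q + (if i = 1 \<or> j = 1 then 1 else 0) * bernoulli i * bernoulli j"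
proof -
  have pb: "pbernoulli n (real m / real q) = bernpoly n (real (m mod q) / real q)"
    if "\<not> q dvd m" for n m
  proof -
    have "real m / real q \<notin> \<int>"
      using that assms(1)
      by (simp add: frac_of_nat_divide dvd_eq_mod_eq_0 flip: frac_eq_0_iff)
    then show ?thesis
      using assms(1) by (simp add: pbernoulli_def frac_of_nat_divide)
  qed
  have pos: "pbernoulli i (real k / real q) * pbernoulli j (real p * real k / real q) =
      bernpoly i (real k / real q) * bernpoly j (real (p * k mod q) / real q)"
    if "k \<in> {..<q} - {0}" for k
  proof -
    have "\<not> q dvd k" using that by (auto dest: dvd_imp_le)
    moreover from this have "\<not> q dvd p * k"
      using assms(2) by (simp add: coprime_dvd_mult_right_iff coprime_commute)
    ultimately show ?thesis
      using pb[of k i] pb[of "p * k" j] that by simp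
  qed
  have split: "(\<Sum>k<q. f k) = f 0 + (\<Sum>k\<in>{..<q} - {0}. f k)" for f :: "nat \<Rightarrow> real"
    using assms(1) by (intro sum.remove) auto
  have "dedekind_s i j p q = pbernoulli i 0 * pbernoulli j 0 +
      (\<Sum>k\<in>{..<q} - {0}. bernpoly i (real k / real q) * bernpoly j (real (p * k mod q) / real q))"
    unfolding dedekind_s_def split by (simp, intro sum.cong refl pos)
  then show ?thesis
    unfolding split by (simp add: bernpoly_0 pbernoulli_def)
qed

theorem theorem4p1:
  fixes p q i j :: nat and t :: complex and \<delta> :: real
  assumes "p > 0" and "q > 0" and "coprime p q"
    and "i \<ge> 1" and "j \<ge> 1"
    and t: "t / (fact i * fact j) = fps_nth (fps_nth (Td p q) i) j"
    and \<delta>: "\<delta> = (if i = 1 \<or> j = 1 then 1 else 0)"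
  shows "t = complex_of_real
    (- ((- real q) ^ (i + j - 1)) * (dedekind_s i j p q + \<delta> * bernoulli i * bernoulli j))"
proof -
  define S where "S = dedekind_s i j p q + \<delta> * bernoulli i * bernoulli j"
  have S: "(\<Sum>k<q. complex_of_real
      (bernpoly i (real k / real q) * bernpoly j (real (p * k mod q) / real q))) = of_real S"
    unfolding S_def \<delta> sum_bernpoly_eq_dedekind_s[OF assms(2,3), symmetric]
    by (rule of_real_sum [symmetric])
  \<comment> \<open>With n = i + j - 1 written without truncated subtraction, (-q)^(n+1) / q becomes
    -(-q)^n, the source of the leading sign.\<close>
  obtain n where n: "i + j = Suc n" using assms(4) by (cases "i + j") auto
  have "t = (- of_nat q) ^ (i + j) / of_nat q * of_real S"
    using t unfolding Td_nth_eq_sum_bernpoly[OF assms(2)] S by (simp add: field_simps)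
  then show ?thesis
    using assms(2) unfolding S_def[symmetric] n by simp
qed

end
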